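(* Suppose the project (as defined in the context) is indexable with Whittle index $\lambda^*(\cdot)$. Then it is thresholdable if and only if $\lambda^*(\cdot)$ is nondecreasing and continuous on $\mathsf X$, in which case its optimal threshold maps $z^*(\cdot)$ are precisely the generalized inverses of $\lambda^*(\cdot)$, and these are (strictly) increasing on $\lambda^*(\mathsf X)$.
   Context: Project model. $\mathsf X=\{x\in\mathbb R:\ell\le x\le u\}$ with $-\infty\le\ell<u\le\infty$; all sets and functions are Borel measurable. A project has state $X_t\in\mathsf X$ and action $A_t\in\{0,1\}$ ($1$ = active, $0$ = passive) at times $t=0,1,\dots$. When $(X_t,A_t)=(x,a)$ it yields reward $r(x,a)$, consumes $c(x,a)$ units of a resource, and $X_{t+1}\sim\kappa^a(x,\cdot)$, with $\kappa^0,\kappa^1$ Markov transition kernels on $\mathsf X$. The discount factor is $\beta\in[0,1)$. Standing assumption: for each $a\in\{0,1\}$, $r(\cdot,a)$ and $c(\cdot,a)$ are continuous on $\mathsf X$, $0\le c(x,0)<c(x,1)$ for all $x$, and there are a function $w:\mathsf X\to[1,\infty)$ and constants $M>0$, $\beta\le\gamma<1$ with $\max\{|r(x,a)|,c(x,a)\}\le M w(x)$ and $\beta\int w(y)\,\kappa^a(x,dy)\le\gamma w(x)$ for all $x,a$. $\Pi$ is the class of nonanticipative (history-dependent, possibly randomized) policies. For $\pi\in\Pi$, $F(x,\pi)=\mathsf E_x^\pi[\sum_{t\ge0}\beta^t r(X_t,A_t)]$, $G(x,\pi)=\mathsf E_x^\pi[\sum_{t\ge0}\beta^t c(X_t,A_t)]$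 with $X_0=x$. For $\lambda\in\mathbb R$, $V_\lambda(x,\pi)=F(x,\pi)-\lambda G(x,\pi)$ and $V^*_\lambda(x)=\sup_{\pi\in\Pi}V_\lambda(x,\pi)$. Let $V_\lambda^{\langle a,*\rangle}(x)=r(x,a)-\lambda c(x,a)+\beta\int V_\lambda^*(y)\,\kappa^a(x,dy)$ and $\Delta_\lambda(x)=V_\lambda^{\langle1,*\rangle}(x)-V_\lambda^{\langle0,*\rangle}(x)$. The project is indexable with Whittle index $\lambda^*:\mathsf X\to\mathbb R$ if $\operatorname{sgn}\Delta_\lambda(x)=\operatorname{sgn}(\lambda^*(x)-\lambda)$ for all $x\in\mathsf X$, $\lambda\in\mathbb R$, where $\operatorname{sgn}\in\{-1,0,1\}$. It is thresholdable if there is a map $z^*:\mathbb R\to\overline{\mathbb R}=\mathbb R\cup\{-\infty,\infty\}$ (called an optimal threshold map) such that for all $x\in\mathsf X$, $\lambda\in\mathbb R$: $x\le z^*(\lambda)$ implies $\Delta_\lambda(x)\le0$, and $x\ge z^*(\lambda)$ implies $\Delta_\lambda(x)\ge0$. Generalized inverses. Let $\varphi:\mathsf X\to\mathbb R$ be nondecreasing and continuous, extended to $\overline{\mathbb R}$ by $\varphi(z)=\varphi(\ell)$ for $z<\ell$ if $\ell>-\infty$, $\varphi(z)=\varphi(u)$ for $z>u$ if $u<\infty$, $\varphi(\pm\infty)=\lim_{z\to\pm\infty}\varphi(z)$. For $\lambda\in\mathbb R$ let $\mathsf Z_\lambda$ be: $\{z\in\overline{\mathbb R}:\varphi(z)=\lambda\}$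 if $\varphi(x)=\lambda$ for some $x\in\mathsf X$; if $\lambda<\varphi(x)$ for all $x\in\mathsf X$, $\{z\in\overline{\mathbb R}:z<\ell\}$ when $\ell>-\infty$ and $\{-\infty\}$ when $\ell=-\infty$; if $\lambda>\varphi(x)$ for all $x\in\mathsf X$, $\{z\in\overline{\mathbb R}:z>u\}$ when $u<\infty$ and $\{\infty\}$ when $u=\infty$. A map $\zeta:\mathbb R\to\overline{\mathbb R}$ is a generalized inverse of $\varphi$ if $\zeta(\lambda)\in\mathsf Z_\lambda$ for all $\lambda\in\mathbb R$. *)

theory Defs
  imports "HOL-Probability.Probability"
begin

datatype action = Passive | Active

record project =
  lower :: ereal
  upper :: ereal
  reward :: "real \<Rightarrow> action \<Rightarrow> real"
  consumption :: "real \<Rightarrow> action \<Rightarrow> real"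
  kernel :: "action \<Rightarrow> real \<Rightarrow> real measure"
  discount :: real

definition states :: "project \<Rightarrow> real set" where
  "states P = {x. lower P \<le> ereal x \<and> ereal x \<le> upper P}"

definition state_space :: "project \<Rightarrow> real measure" where
  "state_space P = restrict_space borel (states P)"

definition action_space :: "action measure" where
  "action_space = count_space UNIV"

text \<open>The weighted drift condition is stated with the nonnegative integral, so that for a positive
  discount factor it includes the integrability of the weight \<open>w\<close>.\<close>

definition valid_project :: "project \<Rightarrow> bool" where
  "valid_project P \<longleftrightarrow>
     lower P < upper P \<and>
     0 \<le> discount P \<and> discount P < 1 \<and>
     (\<forall>a. kernel P a \<in> state_space P \<rightarrow>\<^sub>M prob_algebra (state_space P)) \<and>
     (\<forall>a. continuous_on (states P) (\<lambda>x. reward P x a)) \<and>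
     (\<forall>a. continuous_on (states P) (\<lambda>x. consumption P x a)) \<and>
     (\<forall>x\<in>states P. 0 \<le> consumption P x Passive \<and>
        consumption P x Passive < consumption P x Active) \<and>
     (\<exists>w \<in> borel_measurable (state_space P). \<exists>M \<gamma>.
        M > 0 \<and> discount P \<le> \<gamma> \<and> \<gamma> < 1 \<and>
        (\<forall>x\<in>states P. 1 \<le> w x) \<and>
        (\<forall>x\<in>states P. \<forall>a.
           max \<bar>reward P x a\<bar> (consumption P x a) \<le> M * w x \<and>
           ennreal (discount P) * (\<integral>\<^sup>+ y. ennreal (w y) \<partial>kernel P a x) \<le> ennreal (\<gamma> * w x)))"

text \<open>A history-dependent randomized policy gives, at time \<open>t\<close>, the law of the action
  \<open>A\<^sub>t\<close> as a measurable function of the past \<open>(X\<^sub>0, A\<^sub>0), \<dots>, (X\<^sub>t\<^sub>-\<^sub>1, A\<^sub>t\<^sub>-\<^sub>1)\<close>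
  and of the current state \<open>X\<^sub>t\<close>.\<close>

type_synonym policy = "nat \<Rightarrow> (nat \<Rightarrow> real \<times> action) \<Rightarrow> real \<Rightarrow> action measure"

definition stage_space :: "project \<Rightarrow> (real \<times> action) measure" where
  "stage_space P = state_space P \<Otimes>\<^sub>M action_space"

definition policies :: "project \<Rightarrow> policy set" where
  "policies P = {\<pi>. \<forall>t. (\<lambda>(h, x). \<pi> t h x) \<in>
     (\<Pi>\<^sub>M i\<in>{0..<t}. stage_space P) \<Otimes>\<^sub>M state_space P \<rightarrow>\<^sub>M prob_algebra action_space}"

definition next_state :: "project \<Rightarrow> real \<Rightarrow> nat \<Rightarrow> (nat \<Rightarrow> real \<times> action) \<Rightarrow> real measure" where
  "next_state P x t h =
     (case t of 0 \<Rightarrow> return (state_space P) x | Suc s \<Rightarrow> kernel P (snd (h s)) (fst (h s)))"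

definition next_stage ::
    "project \<Rightarrow> policy \<Rightarrow> real \<Rightarrow> nat \<Rightarrow> (nat \<Rightarrow> real \<times> action) \<Rightarrow> (real \<times> action) measure" where
  "next_stage P \<pi> x t h =
     next_state P x t h \<bind> (\<lambda>y. distr (\<pi> t h y) (stage_space P) (Pair y))"

text \<open>The law of the state-action process \<open>(X\<^sub>t, A\<^sub>t)\<^sub>t\<close> under policy \<open>\<pi>\<close> from
  \<open>X\<^sub>0 = x\<close>: the Ionescu-Tulcea extension of the one-stage laws. The locale hypotheses hold
  by \<open>Ionescu_Tulcea_next_stage\<close> below.\<close>

definition trajectory :: "project \<Rightarrow> policy \<Rightarrow> real \<Rightarrow> (nat \<Rightarrow> real \<times> action) measure" where
  "trajectory P \<pi> x =
     projective_family.lim UNIV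
       (Ionescu_Tulcea.CI (next_stage P \<pi> x) (\<lambda>_. stage_space P)) (\<lambda>_. stage_space P)"

definition reward_measure :: "project \<Rightarrow> real \<Rightarrow> policy \<Rightarrow> real" where
  "reward_measure P x \<pi> =
     (\<integral>\<omega>. (\<Sum>t. discount P ^ t * reward P (fst (\<omega> t)) (snd (\<omega> t))) \<partial>trajectory P \<pi> x)"

definition resource_measure :: "project \<Rightarrow> real \<Rightarrow> policy \<Rightarrow> real" where
  "resource_measure P x \<pi> =
     (\<integral>\<omega>. (\<Sum>t. discount P ^ t * consumption P (fst (\<omega> t)) (snd (\<omega> t))) \<partial>trajectory P \<pi> x)"

definition net_value :: "project \<Rightarrow> real \<Rightarrow> real \<Rightarrow> policy \<Rightarrow> real" where
  "net_value P lam x \<pi> = reward_measure P x \<pi> - lam * resource_measure P x \<pi>"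

definition optimal_value :: "project \<Rightarrow> real \<Rightarrow> real \<Rightarrow> real" where
  "optimal_value P lam x = (SUP \<pi>\<in>policies P. net_value P lam x \<pi>)"

definition action_value :: "project \<Rightarrow> real \<Rightarrow> action \<Rightarrow> real \<Rightarrow> real" where
  "action_value P lam a x = reward P x a - lam * consumption P x a
     + discount P * (\<integral>y. optimal_value P lam y \<partial>kernel P a x)"

definition advantage :: "project \<Rightarrow> real \<Rightarrow> real \<Rightarrow> real" where
  "advantage P lam x = action_value P lam Active x - action_value P lam Passive x"

definition indexable_with :: "project \<Rightarrow> (real \<Rightarrow> real) \<Rightarrow> bool" where
  "indexable_with P idx \<longleftrightarrow>
     (\<forall>x\<in>states P. \<forall>lam. sgn (advantage P lam x) = sgn (idx x - lam))"

definition optimal_threshold_map :: "project \<Rightarrow> (real \<Rightarrow> ereal) \<Rightarrow> bool" where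
  "optimal_threshold_map P z \<longleftrightarrow>
     (\<forall>x\<in>states P. \<forall>lam. (ereal x \<le> z lam \<longrightarrow> advantage P lam x \<le> 0) \<and>
                       (ereal x \<ge> z lam \<longrightarrow> advantage P lam x \<ge> 0))"

definition thresholdable :: "project \<Rightarrow> bool" where
  "thresholdable P \<longleftrightarrow> (\<exists>z. optimal_threshold_map P z)"

text \<open>In the extension, \<open>z < lower P\<close> forces the lower end to be finite (for a nonempty state
  set), so that the limit in the third line is used only if the state set is unbounded below; likewise above.
  The limits are taken in the extended reals.\<close>

definition extend_index :: "project \<Rightarrow> (real \<Rightarrow> real) \<Rightarrow> ereal \<Rightarrow> ereal" where
  "extend_index P \<phi> z =
     (if z < lower P then ereal (\<phi> (real_of_ereal (lower P)))
      else if upper P < z then ereal (\<phi> (real_of_ereal (upper P)))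
      else if z = -\<infinity> then Lim at_bot (\<lambda>x. ereal (\<phi> x))
      else if z = \<infinity> then Lim at_top (\<lambda>x. ereal (\<phi> x))
      else ereal (\<phi> (real_of_ereal z)))"

text \<open>Meant for \<open>\<phi>\<close> nondecreasing and continuous on the state set, where one of the first three
  cases always applies.\<close>

definition inverse_set :: "project \<Rightarrow> (real \<Rightarrow> real) \<Rightarrow> real \<Rightarrow> ereal set" where
  "inverse_set P \<phi> lam =
     (if \<exists>x\<in>states P. \<phi> x = lam then {z. extend_index P \<phi> z = ereal lam}
      else if \<forall>x\<in>states P. lam < \<phi> x then
        (if lower P > -\<infinity> then {z. z < lower P} else {-\<infinity>})
      else if \<forall>x\<in>states P. lam > \<phi> x then
        (if upper P < \<infinity> then {z. z > upper P} else {\<infinity>})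
      else {})"

definition generalized_inverse :: "project \<Rightarrow> (real \<Rightarrow> real) \<Rightarrow> (real \<Rightarrow> ereal) \<Rightarrow> bool" where
  "generalized_inverse P \<phi> \<zeta> \<longleftrightarrow> (\<forall>lam. \<zeta> lam \<in> inverse_set P \<phi> lam)"

lemma Ionescu_Tulcea_next_stage:
  assumes P: "valid_project P" and \<pi>: "\<pi> \<in> policies P" and x: "x \<in> states P"
  shows "Ionescu_Tulcea (next_stage P \<pi> x) (\<lambda>_. stage_space P)"
proof -
  have meas: "next_stage P \<pi> x t \<in> (\<Pi>\<^sub>M i\<in>{0..<t}. stage_space P) \<rightarrow>\<^sub>M prob_algebra (stage_space P)"
    for t
  proof -
    let ?H = "\<Pi>\<^sub>M i\<in>{0..<t}. stage_space P"
    have \<pi>t: "(\<lambda>(h, x). \<pi> t h x) \<in> ?H \<Otimes>\<^sub>M state_space P \<rightarrow>\<^sub>M prob_algebra action_space"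
      using \<pi> by (simp add: policies_def)
    have n: "next_state P x t \<in> ?H \<rightarrow>\<^sub>M prob_algebra (state_space P)"
    proof (cases t)
      case 0
      have "return (state_space P) x \<in> space (prob_algebra (state_space P))"
        using x by (auto simp: space_prob_algebra state_space_def space_restrict_space
                         intro!: prob_space_return)
      then show ?thesis
        by (simp add: 0 next_state_def[abs_def])
    next
      case (Suc s)
      have k: "(\<lambda>p. kernel P (snd p) (fst p)) \<in> stage_space P \<rightarrow>\<^sub>M prob_algebra (state_space P)"
        unfolding stage_space_def action_space_def
      proof (rule measurable_compose_countable'[where I=UNIV and g=snd])
        show "countable (UNIV :: action set)"
          by (rule countable_subset[of _ "{Passive, Active}"]) (auto intro: action.exhaust)
      qed (use P in \<open>auto simp: valid_project_def intro: measurable_compose[OF measurable_fst]\<close>)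
      have "(\<lambda>h. h s) \<in> ?H \<rightarrow>\<^sub>M stage_space P"
        by (rule measurable_component_singleton) (simp add: Suc)
      from measurable_compose[OF this k] show ?thesis
        by (simp add: Suc next_state_def[abs_def])
    qed
    show ?thesis
      unfolding next_stage_def[abs_def]
    proof (rule measurable_bind_prob_space2[OF n])
      have "(\<lambda>q. distr (\<pi> t (fst q) (snd q)) (stage_space P) (Pair (snd q)))
              \<in> ?H \<Otimes>\<^sub>M state_space P \<rightarrow>\<^sub>M prob_algebra (stage_space P)"
      proof (rule measurable_distr_prob_space2[where M=action_space])
        show "(\<lambda>q. \<pi> t (fst q) (snd q)) \<in> ?H \<Otimes>\<^sub>M state_space P \<rightarrow>\<^sub>M prob_algebra action_space"
          using \<pi>t by (simp add: split_beta')
        show "(\<lambda>(q, a). (snd q, a)) \<in> (?H \<Otimes>\<^sub>M state_space P) \<Otimes>\<^sub>M action_space \<rightarrow>\<^sub>M stage_space P"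
          unfolding stage_space_def by measurable
      qed
      then show "(\<lambda>(h, y). distr (\<pi> t h y) (stage_space P) (Pair y))
              \<in> ?H \<Otimes>\<^sub>M state_space P \<rightarrow>\<^sub>M prob_algebra (stage_space P)"
        by (simp add: split_beta')
    qed
  qed
  show ?thesis
  proof (rule Ionescu_Tulcea.intro)
    show "next_stage P \<pi> x t \<in> (\<Pi>\<^sub>M i\<in>{0..<t}. stage_space P) \<rightarrow>\<^sub>M subprob_algebra (stage_space P)" for t
      using meas by (rule measurable_prob_algebraD)
    show "prob_space (next_stage P \<pi> x t h)" if "h \<in> space (\<Pi>\<^sub>M i\<in>{0..<t}. stage_space P)" for t h
      using measurable_space[OF meas that] by (simp add: space_prob_algebra)
  qed
qed

end

theory Submission
  imports Defs
begin

text \<open>Indexability turns the sign conditions on the advantage into sign conditions on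
  \<open>idx x - lam\<close>, so that \<open>z lam\<close> only has to separate the states with \<open>idx x < lam\<close> from those
  with \<open>idx x > lam\<close>. Such a separation for every \<open>lam\<close> excludes both decreases and jumps of the index. Conversely, for a nondecreasing
  continuous index the separating points of level \<open>lam\<close> are exactly the elements of
  \<open>inverse_set P idx lam\<close>, and the intermediate value theorem makes the threshold increase
  strictly between two levels that are attained.\<close>

section \<open>Separation of the states at a level\<close>

text \<open>Both implications apply at a state equal to \<open>z\<close>, so such a state has index
  exactly \<open>lam\<close>. The point \<open>z\<close> is an extended real and may lie outside the
  state set.\<close>

definition separates :: "project \<Rightarrow> (real \<Rightarrow> real) \<Rightarrow> real \<Rightarrow> ereal \<Rightarrow> bool" where
  "separates P \<phi> lam z \<longleftrightarrow>
     (\<forall>x\<in>states P. (ereal x \<le> z \<longrightarrow> \<phi> x \<le> lam) \<and> (z \<le> ereal x \<longrightarrow> lam \<le> \<phi> x))"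

lemma separates_le:
  assumes "separates P \<phi> lam z" "x \<in> states P"
  shows "ereal x \<le> z \<Longrightarrow> \<phi> x \<le> lam" and "z \<le> ereal x \<Longrightarrow> lam \<le> \<phi> x"
  using assms unfolding separates_def by blast+

lemma separates_less:
  assumes "separates P \<phi> lam z" "x \<in> states P"
  shows "\<phi> x < lam \<Longrightarrow> ereal x < z" and "lam < \<phi> x \<Longrightarrow> z < ereal x"
  using separates_le[OF assms] by (force simp flip: not_le)+

text \<open>Equal signs turn the two weak inequalities for the advantage into those for
  \<open>idx x - lam\<close>. The dynamics and the discounting enter the argument only through this
  sign.\<close>

lemma optimal_threshold_map_iff_separates:
  assumes "indexable_with P idx"
  shows "optimal_threshold_map P z \<longleftrightarrow> (\<forall>lam. separates P idx lam (z lam))"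
proof -
  have "advantage P lam x \<le> 0 \<longleftrightarrow> idx x \<le> lam" "0 \<le> advantage P lam x \<longleftrightarrow> lam \<le> idx x"
    if "x \<in> states P" for x lam
  proof -
    have "sgn (advantage P lam x) = sgn (idx x - lam)"
      using assms that by (simp add: indexable_with_def)
    then show "advantage P lam x \<le> 0 \<longleftrightarrow> idx x \<le> lam" "0 \<le> advantage P lam x \<longleftrightarrow> lam \<le> idx x"
      by (auto simp: sgn_if split: if_splits)
  qed
  then show ?thesis
    unfolding optimal_threshold_map_def separates_def by auto
qed

section \<open>Monotonicity and continuity forced by separation\<close>

text \<open>If the index decreased from \<open>x\<close> to \<open>y\<close>, the threshold of a
  level strictly between the two values would have \<open>y\<close> to its left and \<open>x\<close>
  to its right, against \<open>x \<le> y\<close>.\<close>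

lemma separates_imp_mono_on:
  assumes "\<And>lam. separates P \<phi> lam (z lam)"
  shows "mono_on (states P) \<phi>"
proof (rule mono_onI, rule ccontr)
  fix x y assume xy: "x \<in> states P" "y \<in> states P" "x \<le> y" and "\<not> \<phi> x \<le> \<phi> y"
  then have "\<phi> y < \<phi> x" by simp
  then obtain lam where "\<phi> y < lam" "lam < \<phi> x"
    using dense[of "\<phi> y" "\<phi> x"] by auto
  then have "ereal y < z lam" "z lam < ereal x"
    using separates_less[OF assms] xy by simp_all
  then have "ereal y < ereal x" by (rule less_trans)
  with \<open>x \<le> y\<close> show False by simp
qed

text \<open>A level strictly between \<open>a\<close> and \<open>\<phi> x\<close> has its threshold
  strictly on one side of \<open>x\<close>. States close to \<open>x\<close> lie on the same side of
  this threshold as \<open>x\<close>, and there separation bounds \<open>\<phi>\<close> by the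
  level.\<close>

lemma separates_imp_continuous_on:
  assumes z: "\<And>lam. separates P \<phi> lam (z lam)"
  shows "continuous_on (states P) \<phi>"
  unfolding continuous_on_def
proof (intro ballI order_tendstoI)
  fix x a assume x: "x \<in> states P"
  \<comment> \<open>The convergence is stated in the extended reals because \<open>z lam\<close> may
    be infinite.\<close>
  have lim: "((\<lambda>y. ereal y) \<longlongrightarrow> ereal x) (at x within states P)"
    by (intro tendsto_intros)
  have S: "eventually (\<lambda>y. y \<in> states P) (at x within states P)"
    by (auto simp: eventually_at_filter)
  show "eventually (\<lambda>y. a < \<phi> y) (at x within states P)" if a: "a < \<phi> x"
  proof -
    obtain lam where "a < lam" "lam < \<phi> x" using dense[OF a] by blast
    then have "z lam < ereal x" using separates_less[OF z x] by simp
    from order_tendstoD(1)[OF lim this] S show ?thesis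
      by eventually_elim (rule less_le_trans[OF \<open>a < lam\<close> separates_le(2)[OF z _ less_imp_le]])
  qed
  show "eventually (\<lambda>y. \<phi> y < a) (at x within states P)" if a: "\<phi> x < a"
  proof -
    obtain lam where "\<phi> x < lam" "lam < a" using dense[OF a] by blast
    then have "ereal x < z lam" using separates_less[OF z x] by simp
    from order_tendstoD(2)[OF lim this] S show ?thesis
      by eventually_elim (rule le_less_trans[OF separates_le(1)[OF z _ less_imp_le] \<open>lam < a\<close>])
  qed
qed

section \<open>Limits at infinity and the interval of states\<close>

text \<open>This evaluates the \<open>Lim\<close> in \<open>extend_index\<close>. The infimum bounds
  \<open>f\<close> from below on \<open>S\<close>, and once \<open>f y < a\<close>, monotonicity
  keeps \<open>f\<close> below \<open>a\<close> at all points of \<open>S\<close> left of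
  \<open>y\<close>.\<close>

lemma Lim_at_bot_mono_on:
  fixes f :: "real \<Rightarrow> ereal"
  assumes f: "mono_on S f" and S: "eventually (\<lambda>x. x \<in> S) at_bot"
  shows "Lim at_bot f = (INF x\<in>S. f x)"
proof (intro tendsto_Lim order_tendstoI)
  show "eventually (\<lambda>x. a < f x) at_bot" if "a < (INF x\<in>S. f x)" for a
    using S by eventually_elim (rule less_le_trans[OF that INF_lower])
  show "eventually (\<lambda>x. f x < a) at_bot" if a: "(INF x\<in>S. f x) < a" for a
  proof -
    obtain y where y: "y \<in> S" "f y < a" using a by (auto simp: INF_less_iff)
    show ?thesis
      using S eventually_le_at_bot[of y]
      by eventually_elim (rule le_less_trans[OF mono_onD[OF f _ y(1)] y(2)])
  qed
qed simp

lemma Lim_at_top_mono_on: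
  fixes f :: "real \<Rightarrow> ereal"
  assumes f: "mono_on S f" and S: "eventually (\<lambda>x. x \<in> S) at_top"
  shows "Lim at_top f = (SUP x\<in>S. f x)"
proof (intro tendsto_Lim order_tendstoI)
  show "eventually (\<lambda>x. f x < a) at_top" if "(SUP x\<in>S. f x) < a" for a
    using S by eventually_elim (rule le_less_trans[OF SUP_upper that])
  show "eventually (\<lambda>x. a < f x) at_top" if a: "a < (SUP x\<in>S. f x)" for a
  proof -
    obtain y where y: "y \<in> S" "a < f y" using a by (auto simp: less_SUP_iff)
    show ?thesis
      using S eventually_ge_at_top[of y]
      by eventually_elim (rule less_le_trans[OF y(2) mono_onD[OF f y(1)]])
  qed
qed simp

lemma eventually_states_at_bot:
  assumes "lower P = -\<infinity>" "lower P < upper P"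
  shows "eventually (\<lambda>x. x \<in> states P) at_bot"
proof -
  \<comment> \<open>Since \<open>upper P\<close> may be infinite, a real below it comes from
    density; every real up to \<open>b\<close> is then a state.\<close>
  obtain b where b: "ereal b < upper P"
    using assms by (metis ereal_dense2)
  show ?thesis
    using eventually_le_at_bot[of b]
    by eventually_elim
      (use b assms in \<open>auto simp: states_def intro: order_trans[of _ "ereal b"] less_imp_le\<close>)
qed

lemma eventually_states_at_top:
  assumes "upper P = \<infinity>" "lower P < upper P"
  shows "eventually (\<lambda>x. x \<in> states P) at_top"
proof -
  obtain b where b: "lower P < ereal b"
    using assms by (metis ereal_dense2)
  show ?thesis
    using eventually_ge_at_top[of b]
    by eventually_elim
      (use b assms in \<open>auto simp: states_def intro: order_trans[of _ "ereal b"] less_imp_le\<close>)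
qed

lemma states_nonempty: "lower P < upper P \<Longrightarrow> states P \<noteq> {}"
  using ereal_dense2[of "lower P" "upper P"] by (auto simp: states_def intro: less_imp_le)

lemma connected_states: "connected (states P)"
proof -
  have "is_interval (states P)"
    unfolding is_interval_1 states_def
    by (auto intro: order_trans[of _ "ereal _" "ereal _"] order_trans[of "ereal _" "ereal _"]
             simp flip: ereal_less_eq(3))
  then show ?thesis by (rule is_interval_connected)
qed

text \<open>The image of the interval of states is connected, so \<open>x\<close> and
  \<open>y\<close> may come in either order and the interval may be unbounded.\<close>

lemma IVT_states:
  assumes "continuous_on (states P) \<phi>" "x \<in> states P" "y \<in> states P" "\<phi> x \<le> lam" "lam \<le> \<phi> y"
  shows "\<exists>v\<in>states P. \<phi> v = (lam :: real)"
proof -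
  have "connected (\<phi> ` states P)"
    by (intro connected_continuous_image assms connected_states)
  then have "lam \<in> \<phi> ` states P"
    using assms connectedD_interval by blast
  then show ?thesis by blast
qed

section \<open>Generalized inverses as separating points\<close>

text \<open>For \<open>z\<close> infinite or outside the states, the extension is the infimum or
  supremum of \<open>\<phi>\<close>, and separation says that \<open>lam\<close> is a lower or upper
  bound. As \<open>lam\<close> is attained at \<open>v\<close>, such a bound is the extreme value
  itself.\<close>

lemma extend_index_eq_iff_separates:
  assumes lu: "lower P < upper P" and mono: "mono_on (states P) \<phi>"
    and v: "v \<in> states P" "\<phi> v = lam"
  shows "extend_index P \<phi> z = ereal lam \<longleftrightarrow> separates P \<phi> lam z"
proof -
  have m: "\<phi> x \<le> \<phi> y" if "x \<in> states P" "y \<in> states P" "x \<le> y" for x y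
    using mono that by (rule mono_onD)
  have me: "mono_on (states P) (\<lambda>x. ereal (\<phi> x))"
    using mono by (auto simp: mono_on_def)
  \<comment> \<open>In the cases \<open>bot\<close> and \<open>top\<close> the bounds on
    \<open>z\<close> force the corresponding end of the interval to be infinite, so that the limits
    in \<open>extend_index\<close> apply.\<close>
  consider (below) "z < lower P" | (above) "upper P < z"
    | (bot) "lower P \<le> z" "z \<le> upper P" "z = -\<infinity>"
    | (top) "lower P \<le> z" "z \<le> upper P" "z = \<infinity>"
    | (inside) r where "z = ereal r" "r \<in> states P"
    by (cases z) (auto simp: states_def, meson not_le)
  then show ?thesis
  proof cases
    case below
    then obtain l where l: "lower P = ereal l"
      using lu by (cases "lower P") auto
    then have lS: "l \<in> states P" using lu by (simp add: states_def)
    have ge: "l \<le> x" if "x \<in> states P" for x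
      using that by (simp add: states_def l)
    have z: "z < ereal x" if "x \<in> states P" for x
      using that below by (auto simp: states_def)
    have "separates P \<phi> lam z \<longleftrightarrow> (\<forall>x\<in>states P. lam \<le> \<phi> x)"
      unfolding separates_def
      by (intro ball_cong refl) (simp add: z[unfolded not_le[symmetric]] z[THEN less_imp_le])
    \<comment> \<open>The inequality \<open>\<phi> l \<le> \<phi> v = lam\<close> always holds
      because \<open>l\<close> is the least state; the bound supplies the reverse one.\<close>
    also have "\<dots> \<longleftrightarrow> \<phi> l = lam"
      using m[OF lS _ ge] lS v by (auto intro: order_antisym)
    finally show ?thesis using below by (simp add: extend_index_def l)
  next
    case above
    then obtain u where u: "upper P = ereal u"
      using lu by (cases "upper P") auto
    then have uS: "u \<in> states P" using lu by (simp add: states_def)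
    have le: "x \<le> u" if "x \<in> states P" for x
      using that by (simp add: states_def u)
    have z: "ereal x < z" if "x \<in> states P" for x
      using that above by (auto simp: states_def)
    have "separates P \<phi> lam z \<longleftrightarrow> (\<forall>x\<in>states P. \<phi> x \<le> lam)"
      unfolding separates_def
      by (intro ball_cong refl) (simp add: z[unfolded not_le[symmetric]] z[THEN less_imp_le])
    also have "\<dots> \<longleftrightarrow> \<phi> u = lam"
      using m[OF _ uS le] uS v by (auto intro: order_antisym)
    finally show ?thesis using above lu by (auto simp: extend_index_def u)
  next
    case bot
    then have "extend_index P \<phi> z = (INF x\<in>states P. ereal (\<phi> x))"
      using Lim_at_bot_mono_on[OF me eventually_states_at_bot] lu by (simp add: extend_index_def)
    also have "\<dots> = ereal lam \<longleftrightarrow> (\<forall>x\<in>states P. lam \<le> \<phi> x)"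
    proof
      show "\<forall>x\<in>states P. lam \<le> \<phi> x" if "(INF x\<in>states P. ereal (\<phi> x)) = ereal lam"
        using that by (metis INF_lower ereal_less_eq(3))
      show "(INF x\<in>states P. ereal (\<phi> x)) = ereal lam" if "\<forall>x\<in>states P. lam \<le> \<phi> x"
        using that v by (intro order_antisym INF_lower2[of v] INF_greatest) auto
    qed
    finally show ?thesis using bot by (simp add: separates_def)
  next
    case top
    then have "extend_index P \<phi> z = (SUP x\<in>states P. ereal (\<phi> x))"
      using Lim_at_top_mono_on[OF me eventually_states_at_top] lu by (simp add: extend_index_def)
    also have "\<dots> = ereal lam \<longleftrightarrow> (\<forall>x\<in>states P. \<phi> x \<le> lam)"
    proof
      show "\<forall>x\<in>states P. \<phi> x \<le> lam" if "(SUP x\<in>states P. ereal (\<phi> x)) = ereal lam"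
        using that by (metis SUP_upper ereal_less_eq(3))
      show "(SUP x\<in>states P. ereal (\<phi> x)) = ereal lam" if "\<forall>x\<in>states P. \<phi> x \<le> lam"
        using that v by (intro order_antisym SUP_upper2[of v] SUP_least) auto
    qed
    finally show ?thesis using top by (simp add: separates_def)
  next
    case inside
    then have "extend_index P \<phi> z = ereal (\<phi> r)"
      by (auto simp: extend_index_def states_def)
    \<comment> \<open>The state \<open>r\<close> satisfies both premises of separation, which forces
      equality; monotonicity gives the converse.\<close>
    moreover have "separates P \<phi> lam z \<longleftrightarrow> \<phi> r = lam"
      using m inside by (auto simp: separates_def intro: order_antisym)
    ultimately show ?thesis by simp
  qed
qed

lemma inverse_set_iff_separates:
  assumes lu: "lower P < upper P" and mono: "mono_on (states P) \<phi>"
    and cont: "continuous_on (states P) \<phi>"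
  shows "z \<in> inverse_set P \<phi> lam \<longleftrightarrow> separates P \<phi> lam z"
proof -
  \<comment> \<open>A level neither below nor above all values lies between two of them and is
    attained by \<open>IVT_states\<close>. Hence the empty default of \<open>inverse_set\<close>
    never occurs.\<close>
  consider (attained) v where "v \<in> states P" "\<phi> v = lam"
    | (below) "\<forall>x\<in>states P. lam < \<phi> x" | (above) "\<forall>x\<in>states P. \<phi> x < lam"
    using IVT_states[OF cont] by (meson linorder_not_less order.strict_iff_order)
  then show ?thesis
  proof cases
    case attained
    then show ?thesis
      using extend_index_eq_iff_separates[OF lu mono attained] by (auto simp: inverse_set_def)
  next
    case below
    \<comment> \<open>With every value above \<open>lam\<close>, the first implication fails at any
      state up to \<open>z\<close>, and the second always holds.\<close>
    have "separates P \<phi> lam z \<longleftrightarrow> (\<forall>x\<in>states P. z < ereal x)"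
      using below by (auto simp: separates_def not_le[symmetric] intro: less_imp_le)
    also have "\<dots> \<longleftrightarrow> (if lower P > -\<infinity> then z < lower P else z = -\<infinity>)"
    proof (cases "lower P = -\<infinity>")
      case True
      \<comment> \<open>There are states left of every real \<open>B\<close>, and \<open>z\<close>
        lies below all of them.\<close>
      have "z = -\<infinity>" if "\<forall>x\<in>states P. z < ereal x"
      proof (rule ereal_bot)
        fix B :: real
        have "eventually (\<lambda>x. x \<in> states P \<and> x \<le> B) at_bot"
          using eventually_states_at_bot[OF True lu] eventually_le_at_bot by (rule eventually_conj)
        then obtain x where "x \<in> states P" "x \<le> B"
          using eventually_happens trivial_limit_at_bot_linorder by blast
        then show "z \<le> ereal B"
          using that by (meson ereal_less_eq(3) less_imp_le order_trans)
      qed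
      with True show ?thesis by auto
    next
      case False
      then obtain l where l: "lower P = ereal l" using lu by (cases "lower P") auto
      then have "l \<in> states P" using lu by (simp add: states_def)
      then show ?thesis using l by (auto simp: states_def intro: less_le_trans[of _ "ereal l"])
    qed
    finally show ?thesis using below by (auto simp: inverse_set_def)
  next
    case above
    \<comment> \<open>In \<open>inverse_set\<close> the test for a level below all values precedes
      the test for one above; a state is needed to refute the former.\<close>
    obtain w where w: "w \<in> states P" using states_nonempty[OF lu] by blast
    have "separates P \<phi> lam z \<longleftrightarrow> (\<forall>x\<in>states P. ereal x < z)"
      using above by (auto simp: separates_def not_le[symmetric] intro: less_imp_le)
    also have "\<dots> \<longleftrightarrow> (if upper P < \<infinity> then z > upper P else z = \<infinity>)"
    proof (cases "upper P = \<infinity>")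
      case True
      have "z = \<infinity>" if "\<forall>x\<in>states P. ereal x < z"
      proof (rule ereal_top)
        fix B :: real
        have "eventually (\<lambda>x. x \<in> states P \<and> B \<le> x) at_top"
          using eventually_states_at_top[OF True lu] eventually_ge_at_top by (rule eventually_conj)
        then obtain x where "x \<in> states P" "B \<le> x"
          using eventually_happens trivial_limit_at_top_linorder by blast
        then show "ereal B \<le> z"
          using that by (meson ereal_less_eq(3) less_imp_le order_trans)
      qed
      with True show ?thesis by auto
    next
      case False
      then obtain u where u: "upper P = ereal u" using lu by (cases "upper P") auto
      then have "u \<in> states P" using lu by (simp add: states_def)
      then show ?thesis using u by (auto simp: states_def intro: le_less_trans[of _ "ereal u"])
    qed
    finally show ?thesis using above w by (force simp: inverse_set_def)
  qed
qed

section \<open>Existence and strict growth of thresholds\<close>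

text \<open>An attained level is separated by a state attaining it; for any other level an infinite
  point, with all states on one side, will do.\<close>

lemma separates_ex:
  assumes lu: "lower P < upper P" and mono: "mono_on (states P) \<phi>"
    and cont: "continuous_on (states P) \<phi>"
  shows "\<exists>z. separates P \<phi> lam z"
proof -
  consider v where "v \<in> states P" "\<phi> v = lam"
    | "\<forall>x\<in>states P. lam < \<phi> x" | "\<forall>x\<in>states P. \<phi> x < lam"
    using IVT_states[OF cont] by (meson linorder_not_less order.strict_iff_order)
  then show ?thesis
  proof cases
    case 1
    then have "separates P \<phi> lam (ereal v)"
      using mono by (auto simp: separates_def dest: mono_onD)
    then show ?thesis ..
  next
    case 2
    then have "separates P \<phi> lam (-\<infinity>)" by (auto simp: separates_def intro: less_imp_le)
    then show ?thesis ..
  next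
    case 3
    then have "separates P \<phi> lam \<infinity>" by (auto simp: separates_def intro: less_imp_le)
    then show ?thesis ..
  qed
qed

text \<open>A level strictly between two attained ones is itself attained, and a state attaining it
  lies strictly between the two thresholds.\<close>

lemma separates_imp_strict_mono_on:
  assumes cont: "continuous_on (states P) \<phi>" and z: "\<And>lam. separates P \<phi> lam (z lam)"
  shows "strict_mono_on (\<phi> ` states P) z"
proof (rule strict_mono_onI)
  fix a b assume ab: "a \<in> \<phi> ` states P" "b \<in> \<phi> ` states P" "a < b"
  obtain lam where lam: "a < lam" "lam < b" using dense[OF \<open>a < b\<close>] by blast
  obtain v where v: "v \<in> states P" "\<phi> v = lam"
    using IVT_states[OF cont] ab lam by (metis imageE less_imp_le)
  have "z a < ereal v" "ereal v < z b"
    using separates_less[OF z v(1)] v(2) lam by auto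
  then show "z a < z b" by (rule less_trans)
qed

theorem lemma2:
  fixes P :: project and idx :: "real \<Rightarrow> real"
  assumes "valid_project P"
    and "indexable_with P idx"
  shows "(thresholdable P \<longleftrightarrow> mono_on (states P) idx \<and> continuous_on (states P) idx) \<and>
    (thresholdable P \<longrightarrow>
       (\<forall>z. optimal_threshold_map P z \<longleftrightarrow> generalized_inverse P idx z) \<and>
       (\<forall>z. generalized_inverse P idx z \<longrightarrow> strict_mono_on (idx ` states P) z))"
proof -
  have lu: "lower P < upper P"
    using assms(1) by (simp add: valid_project_def)
  note otm = optimal_threshold_map_iff_separates[OF assms(2)]
  have thr: "thresholdable P \<longleftrightarrow> mono_on (states P) idx \<and> continuous_on (states P) idx"
  proof
    assume "thresholdable P"
    then obtain z where "\<And>lam. separates P idx lam (z lam)"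
      by (auto simp: thresholdable_def otm)
    then show "mono_on (states P) idx \<and> continuous_on (states P) idx"
      by (intro conjI separates_imp_mono_on separates_imp_continuous_on)
  next
    assume "mono_on (states P) idx \<and> continuous_on (states P) idx"
    then have "\<forall>lam. \<exists>z. separates P idx lam z"
      using separates_ex[OF lu] by blast
    \<comment> \<open>Each level is constrained separately, so thresholds can be chosen level by
      level.\<close>
    then show "thresholdable P"
      unfolding thresholdable_def otm by (rule choice)
  qed
  \<comment> \<open>Thresholdability enters through \<open>thr\<close>, which supplies the
    monotonicity and continuity under which \<open>inverse_set\<close> consists of the separating
    points.\<close>
  have gen: "generalized_inverse P idx z \<longleftrightarrow> (\<forall>lam. separates P idx lam (z lam))"
    if "thresholdable P" for z
    using that thr inverse_set_iff_separates[OF lu] by (simp add: generalized_inverse_def)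
  show ?thesis
    using thr gen otm separates_imp_strict_mono_on by auto
qed

end
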